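(* For all nonnegative integers $k,n$, $a_{k,n}$ equals the number of pairs $(c_1,c_2)$, where $c_1$ is an ordered composition of $k$ and $c_2$ is an ordered composition of $n$, each with all summands in $\{1,2\}$, such that $c_1$ and $c_2$ contain the same number of summands equal to $1$.
   Context: For nonnegative integers $k,n$, let $a_{k,n}$ be the number of ways to partition a set consisting of $k$ marked points on a line and $n$ marked points on a parallel line into pairs, joining the two points of each pair by a straight segment, such that no two segments have a common point (in particular, no endpoint lies on another segment). We have $a_{0,0}=1$. A composition of $m$ is a representation of $m$ as an ordered sum of positive integers. Sums differing in the order of the summands are considered different. The number $0$ has exactly one composition, the empty one. *)

theory Defs
  imports "HOL-Analysis.Analysis" "HOL-Library.Disjoint_Sets"
begin

definition parallel_lines :: "(real^2) set \<Rightarrow> (real^2) set \<Rightarrow> bool" where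
  "parallel_lines L\<^sub>1 L\<^sub>2 \<longleftrightarrow>
     affine L\<^sub>1 \<and> aff_dim L\<^sub>1 = 1 \<and> affine L\<^sub>2 \<and> aff_dim L\<^sub>2 = 1 \<and>
     affine_parallel L\<^sub>1 L\<^sub>2 \<and> L\<^sub>1 \<noteq> L\<^sub>2"

definition pairing :: "'a set \<Rightarrow> 'a set set \<Rightarrow> bool" where
  "pairing A M \<longleftrightarrow> partition_on A M \<and> (\<forall>B\<in>M. card B = 2)"

definition disjoint_segments :: "(real^2) set set \<Rightarrow> bool" where
  "disjoint_segments M \<longleftrightarrow>
     (\<forall>p q r s. {p, q} \<in> M \<and> {r, s} \<in> M \<and> {p, q} \<noteq> {r, s} \<longrightarrow>
        closed_segment p q \<inter> closed_segment r s = {})"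

(* The number a_{k,n}, for a concrete choice of the marked points: P is the set of
   the k points on one line, Q the set of the n points on the other.  That it depends only
   on k and n is not built in. *)
definition num_pairings :: "(real^2) set \<Rightarrow> (real^2) set \<Rightarrow> nat" where
  "num_pairings P Q = card {M. pairing (P \<union> Q) M \<and> disjoint_segments M}"

definition composition :: "nat \<Rightarrow> nat list \<Rightarrow> bool" where
  "composition m c \<longleftrightarrow> (\<forall>x\<in>set c. 0 < x) \<and> sum_list c = m"

end

(* Coordinates along the two lines turn the marked points into finite sets X and Y of reals.
   In a noncrossing pairing a segment inside a line joins neighbours, and two segments between
   the lines keep their order. Hence the two rightmost points of X are joined, or the two
   rightmost points of Y are, or the rightmost point of X is joined to that of Y. The first two
   cases may hold together; the third excludes both. Deleting the segments concerned shows that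
   the number of pairings satisfies
     a(k,n) + a(k-2,n-2) = a(k-2,n) + a(k,n-2) + a(k-1,n-1),
   where (k,n) is not (0,0) and terms with a negative index are 0.
   The pairs of compositions satisfy it as well: look whether the first summands are 2. *)

theory Submission
  imports Defs
begin

section \<open>The recurrence for pairs of compositions with equally many ones\<close>

section \<open>Pairs of compositions\<close>

definition composition_pairs :: "nat \<Rightarrow> nat \<Rightarrow> (nat list \<times> nat list) set" where
  "composition_pairs k n = {(c, d). composition k c \<and> set c \<subseteq> {1, 2} \<and>
     composition n d \<and> set d \<subseteq> {1, 2} \<and> count_list c 1 = count_list d 1}"

lemma length_le_sum_list:
  fixes c :: "nat list"
  assumes "\<forall>x\<in>set c. 0 < x"
  shows "length c \<le> sum_list c"
  using assms by (induction c) auto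

lemma finite_composition_pairs: "finite (composition_pairs k n)"
proof (rule finite_subset)
  let ?L = "\<lambda>m. {c. set c \<subseteq> {1, 2::nat} \<and> length c \<le> m}"
  show "composition_pairs k n \<subseteq> ?L k \<times> ?L n"
    using length_le_sum_list by (fastforce simp: composition_pairs_def composition_def)
  show "finite (?L k \<times> ?L n)"
    by (intro finite_cartesian_product finite_lists_length_le) auto
qed

text \<open>A leading 2 does not affect the number of ones, so it can be stripped from one
  composition alone, whereas a leading 1 has to be stripped from both. The bound
  \<open>2 \<le> k\<close> guards against truncated subtraction.\<close>

lemma Cons2_left_composition_pairs:
  "(2 # c, d) \<in> composition_pairs k n \<longleftrightarrow> 2 \<le> k \<and> (c, d) \<in> composition_pairs (k - 2) n"
  by (auto simp: composition_pairs_def composition_def)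

lemma Cons2_right_composition_pairs:
  "(c, 2 # d) \<in> composition_pairs k n \<longleftrightarrow> 2 \<le> n \<and> (c, d) \<in> composition_pairs k (n - 2)"
  by (auto simp: composition_pairs_def composition_def)

lemma Cons1_composition_pairs:
  "(1 # c, 1 # d) \<in> composition_pairs k n \<longleftrightarrow>
    1 \<le> k \<and> 1 \<le> n \<and> (c, d) \<in> composition_pairs (k - 1) (n - 1)"
  by (auto simp: composition_pairs_def composition_def)

text \<open>If neither composition starts with 2, the equal number of ones forbids that exactly one
  of them is empty. The cases for a leading 2 overlap, which causes the correction term in the
  recurrence.\<close>

lemma composition_pairs_cases:
  assumes "(c, d) \<in> composition_pairs k n"
  obtains "c = []" "d = []" | c' where "c = 2 # c'" | d' where "d = 2 # d'"
    | c' d' where "c = 1 # c'" "d = 1 # d'"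
  using assms
  by (cases c; cases d) (auto simp: composition_pairs_def split: if_splits)

lemma Nil_composition_pairs: "([], []) \<in> composition_pairs k n \<longleftrightarrow> k = 0 \<and> n = 0"
  by (auto simp: composition_pairs_def composition_def)

lemma composition_pairs_0_0: "composition_pairs 0 0 = {([], [])}"
proof -
  have "c = [] \<and> d = []" if "(c, d) \<in> composition_pairs 0 0" for c d
    using that by (cases rule: composition_pairs_cases[OF that])
      (simp_all add: Cons2_left_composition_pairs Cons2_right_composition_pairs
        Cons1_composition_pairs del: One_nat_def)
  then show ?thesis using Nil_composition_pairs[of 0 0] by auto
qed

text \<open>Inclusion-exclusion in additive form, which avoids subtraction of natural numbers. It
  serves both the compositions and the pairings.\<close>

lemma card_three_cover:
  assumes "finite T" "T = A \<union> B \<union> C" "(A \<union> B) \<inter> C = {}"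
  shows "card T + card (A \<inter> B) = card A + card B + card C"
proof -
  have "finite A" "finite B" "finite C" using assms by auto
  then show ?thesis
    using assms card_Un_disjoint[of "A \<union> B" C] card_Un_Int[of A B] by simp
qed

text \<open>The classes are: first composition starts with 2, second starts with 2, both start with
  1. At \<open>(0, 0)\<close> the pair of empty lists lies in none of them, hence the
  assumption.\<close>

lemma card_composition_pairs:
  assumes "(k, n) \<noteq> (0, 0)"
  shows "card (composition_pairs k n)
      + (if 2 \<le> k \<and> 2 \<le> n then card (composition_pairs (k - 2) (n - 2)) else 0)
    = (if 2 \<le> k then card (composition_pairs (k - 2) n) else 0)
      + (if 2 \<le> n then card (composition_pairs k (n - 2)) else 0)
      + (if 1 \<le> k \<and> 1 \<le> n then card (composition_pairs (k - 1) (n - 1)) else 0)"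
proof -
  define A where "A = {(c, d) \<in> composition_pairs k n. \<exists>c'. c = 2 # c'}"
  define B where "B = {(c, d) \<in> composition_pairs k n. \<exists>d'. d = 2 # d'}"
  define C where "C = {(c, d) \<in> composition_pairs k n. \<exists>c' d'. c = 1 # c' \<and> d = 1 # d'}"
  have inj: "inj_on (\<lambda>(c, d). (2 # c, d)) S" "inj_on (\<lambda>(c, d). (c, 2 # d)) S"
      "inj_on (\<lambda>(c, d). (1 # c, 1 # d)) S" "inj_on (\<lambda>(c, d). (2 # c, 2 # d)) S"
    for S :: "(nat list \<times> nat list) set"
    by (auto simp: inj_on_def)
  have A: "A = (if 2 \<le> k then (\<lambda>(c, d). (2 # c, d)) ` composition_pairs (k - 2) n else {})"
    by (auto simp: A_def Cons2_left_composition_pairs)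
  have B: "B = (if 2 \<le> n then (\<lambda>(c, d). (c, 2 # d)) ` composition_pairs k (n - 2) else {})"
    by (auto simp: B_def Cons2_right_composition_pairs)
  have C: "C = (if 1 \<le> k \<and> 1 \<le> n
      then (\<lambda>(c, d). (1 # c, 1 # d)) ` composition_pairs (k - 1) (n - 1) else {})"
    by (auto simp: C_def Cons1_composition_pairs simp del: One_nat_def)
  have AB: "A \<inter> B = (if 2 \<le> k \<and> 2 \<le> n
      then (\<lambda>(c, d). (2 # c, 2 # d)) ` composition_pairs (k - 2) (n - 2) else {})"
    by (auto simp: A_def B_def Cons2_left_composition_pairs Cons2_right_composition_pairs)
  have "(c, d) \<in> A \<union> B \<union> C" if cd: "(c, d) \<in> composition_pairs k n" for c d
    using cd assms by (cases rule: composition_pairs_cases[OF cd])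
      (auto simp: A_def B_def C_def Nil_composition_pairs)
  then have "composition_pairs k n = A \<union> B \<union> C"
    by (auto simp: A_def B_def C_def)
  moreover have "(A \<union> B) \<inter> C = {}"
    by (auto simp: A_def B_def C_def)
  ultimately have "card (composition_pairs k n) + card (A \<inter> B) = card A + card B + card C"
    by (intro card_three_cover finite_composition_pairs)
  moreover have "card A = (if 2 \<le> k then card (composition_pairs (k - 2) n) else 0)"
    unfolding A by (simp add: card_image[OF inj(1)])
  moreover have "card B = (if 2 \<le> n then card (composition_pairs k (n - 2)) else 0)"
    unfolding B by (simp add: card_image[OF inj(2)])
  moreover have "card C =
      (if 1 \<le> k \<and> 1 \<le> n then card (composition_pairs (k - 1) (n - 1)) else 0)"
    unfolding C by (simp add: card_image[OF inj(3)] del: One_nat_def)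
  moreover have "card (A \<inter> B) =
      (if 2 \<le> k \<and> 2 \<le> n then card (composition_pairs (k - 2) (n - 2)) else 0)"
    unfolding AB by (simp add: card_image[OF inj(4)])
  ultimately show ?thesis by simp
qed

section \<open>Deleting and inserting a segment of a noncrossing pairing\<close>

section \<open>Noncrossing pairings\<close>

text \<open>The points form a single set, without reference to the lines, so that deleting the two
  ends of a segment leads to an object of the same kind.\<close>

definition noncrossing_pairings :: "(real^2) set \<Rightarrow> (real^2) set set set" where
  "noncrossing_pairings S = {M. pairing S M \<and> disjoint_segments M}"

lemma finite_noncrossing_pairings:
  assumes "finite S"
  shows "finite (noncrossing_pairings S)"
proof (rule finite_subset)
  show "noncrossing_pairings S \<subseteq> Pow (Pow S)"
    by (auto simp: noncrossing_pairings_def pairing_def partition_on_def)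
qed (use assms in simp)

lemma noncrossing_pairings_empty: "noncrossing_pairings {} = {{}}"
  by (auto simp: noncrossing_pairings_def pairing_def partition_on_def disjoint_segments_def)

lemma pairing_partner:
  assumes "pairing S M" "v \<in> S"
  obtains w where "w \<in> S" "{v, w} \<in> M"
proof -
  obtain e where e: "e \<in> M" "v \<in> e"
    using assms by (auto simp: pairing_def partition_on_def)
  then have "card e = 2" using assms by (auto simp: pairing_def)
  then obtain w where "e = {v, w}"
    using e by (auto simp: card_2_iff)
  then show ?thesis
    using that e assms by (auto simp: pairing_def partition_on_def)
qed

lemma pairing_disjoint: "pairing S M \<Longrightarrow> e \<in> M \<Longrightarrow> f \<in> M \<Longrightarrow> e \<noteq> f \<Longrightarrow> e \<inter> f = {}"
  by (auto simp: pairing_def partition_on_def disjoint_def)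

lemma pairing_partner_unique:
  assumes "pairing S M" "{v, w} \<in> M" "{v, w'} \<in> M"
  shows "w = w'"
proof -
  have "{v, w} = {v, w'}"
    using pairing_disjoint[OF assms] by blast
  then show ?thesis by (auto simp: doubleton_eq_iff)
qed

lemma pairing_neq: "pairing S M \<Longrightarrow> {v, w} \<in> M \<Longrightarrow> v \<noteq> w"
  by (auto simp: pairing_def)

lemma pairing_remove:
  assumes "pairing S M" "e \<in> M"
  shows "pairing (S - e) (M - {e})"
proof -
  have "\<Union>(M - {e}) = S - e"
  proof -
    have "\<Union>M = S" using assms(1) by (simp add: pairing_def partition_on_def)
    moreover have "f \<inter> e = {}" if "f \<in> M - {e}" for f
      using pairing_disjoint[OF assms(1), of f e] assms(2) that by blast
    ultimately show ?thesis using assms(2) by blast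
  qed
  then show ?thesis
    using assms by (auto simp: pairing_def partition_on_def disjoint_def)
qed

lemma pairing_insert:
  assumes "pairing (S - e) M" "card e = 2" "e \<subseteq> S"
  shows "pairing S (insert e M)" "e \<notin> M"
proof -
  have "e \<noteq> {}" using assms by auto
  moreover have U: "\<Union>M = S - e"
    using assms by (auto simp: pairing_def partition_on_def)
  ultimately show "e \<notin> M" by blast
  have "\<Union>(insert e M) = S" using U assms by auto
  moreover have "e \<inter> f = {}" if "f \<in> M" for f using U that by auto
  ultimately show "pairing S (insert e M)"
    using assms \<open>e \<noteq> {}\<close> unfolding pairing_def partition_on_def disjoint_def by auto
qed

text \<open>The condition refers to all pairs of remaining points and not to a pairing, so such an
  edge can be added to every noncrossing pairing of the rest.\<close>

definition separated_edge :: "(real^2) set \<Rightarrow> real^2 \<Rightarrow> real^2 \<Rightarrow> bool" where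
  "separated_edge S v w \<longleftrightarrow> v \<in> S \<and> w \<in> S \<and> v \<noteq> w \<and>
     (\<forall>r\<in>S - {v, w}. \<forall>s\<in>S - {v, w}. closed_segment v w \<inter> closed_segment r s = {})"

lemma disjoint_segments_insert:
  assumes "pairing (S - {v, w}) M" "disjoint_segments M" "separated_edge S v w"
  shows "disjoint_segments (insert {v, w} M)"
proof -
  have in_S: "r \<in> S - {v, w}" "s \<in> S - {v, w}" if "{r, s} \<in> M" for r s
    using assms(1) that unfolding pairing_def partition_on_def by auto
  have d: "closed_segment v w \<inter> closed_segment r s = {}" if "{r, s} \<in> M" for r s
    using assms(3) in_S[OF that] unfolding separated_edge_def by blast
  \<comment> \<open>Edges are unordered pairs, so both orientations of the segment have to be
    covered.\<close>
  have e: "closed_segment p q = closed_segment v w" if "{p, q} = {v, w}" for p q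
    using that by (simp add: segment_convex_hull)
  show ?thesis
    unfolding disjoint_segments_def
  proof (intro allI impI, elim conjE)
    fix p q r s
    assume a: "{p, q} \<in> insert {v, w} M" "{r, s} \<in> insert {v, w} M" "{p, q} \<noteq> {r, s}"
    show "closed_segment p q \<inter> closed_segment r s = {}"
    proof (cases "{p, q} = {v, w}")
      case True
      then have "{r, s} \<in> M" using a by (metis insertE)
      then show ?thesis unfolding e[OF True] by (rule d)
    next
      case False
      then have pq: "{p, q} \<in> M" using a by (metis insertE)
      show ?thesis
      proof (cases "{r, s} = {v, w}")
        case True
        show ?thesis unfolding e[OF True] using d[OF pq] by blast
      next
        case False
        then have "{r, s} \<in> M" using a by (metis insertE)
        then show ?thesis using assms(2) pq a(3) unfolding disjoint_segments_def by blast
      qed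
    qed
  qed
qed

text \<open>Deleting the edge is a bijection with inverse insertion. The predicate \<open>F\<close>
  on the remaining edges allows a second edge to be prescribed, as the overlap of two classes
  requires.\<close>

lemma card_noncrossing_pairings_remove:
  assumes "separated_edge S v w"
  shows "card {M \<in> noncrossing_pairings S. {v, w} \<in> M \<and> F (M - {{v, w}})}
    = card {M \<in> noncrossing_pairings (S - {v, w}). F M}"
proof (rule bij_betw_same_card[of "\<lambda>M. M - {{v, w}}"],
    rule bij_betw_byWitness[where f' = "insert {v, w}"], goal_cases)
  case 1
  then show ?case by auto
next
  case 2
  have "{v, w} \<notin> M" if "M \<in> noncrossing_pairings (S - {v, w})" for M
    using that unfolding noncrossing_pairings_def pairing_def partition_on_def by blast
  then show ?case by auto
next
  case 3
  have "disjoint_segments (M - {{v, w}})" if "disjoint_segments M" for M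
    using that unfolding disjoint_segments_def by (meson DiffD1)
  then show ?case
    by (auto simp: noncrossing_pairings_def intro: pairing_remove)
next
  \<comment> \<open>Insertion is the only direction in which the separation of the edge matters for
    crossings.\<close>
  case 4
  have vw: "card {v, w} = 2" "{v, w} \<subseteq> S"
    using assms by (auto simp: separated_edge_def)
  have "insert {v, w} M \<in> noncrossing_pairings S" "insert {v, w} M - {{v, w}} = M"
    if "M \<in> noncrossing_pairings (S - {v, w})" for M
    using that pairing_insert[of S "{v, w}" M] vw disjoint_segments_insert[of S v w M] assms
    by (auto simp: noncrossing_pairings_def)
  then show ?case by auto
qed

lemmas card_noncrossing_pairings_remove1 =
  card_noncrossing_pairings_remove[where F = "\<lambda>_. True", simplified]

section \<open>Rightmost and second rightmost points\<close>

section \<open>The largest elements of a finite set\<close>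

text \<open>A relation, like \<open>top2\<close> below, and not a function built on
  \<open>Max\<close>: on a set with too few elements it never holds, so no default values
  arise.\<close>

definition top1 :: "real set \<Rightarrow> real \<Rightarrow> bool" where
  "top1 X x \<longleftrightarrow> x \<in> X \<and> (\<forall>r\<in>X. r \<noteq> x \<longrightarrow> r < x)"

definition top2 :: "real set \<Rightarrow> real \<Rightarrow> real \<Rightarrow> bool" where
  "top2 X x x' \<longleftrightarrow> x \<in> X \<and> x' \<in> X \<and> x' < x \<and> (\<forall>r\<in>X. r \<noteq> x \<longrightarrow> r \<noteq> x' \<longrightarrow> r < x')"

lemma top1_exists:
  assumes "finite X" "X \<noteq> {}"
  obtains x where "top1 X x"
proof -
  have "top1 X (Max X)"
    using assms Max_ge[OF assms(1)] Max_in[OF assms] by (auto simp: top1_def order_less_le)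
  then show ?thesis by (rule that)
qed

lemma top1_unique: "top1 X x \<Longrightarrow> top1 X z \<Longrightarrow> x = z"
  unfolding top1_def by (metis order_less_asym)

lemma top2_top1: "top2 X x x' \<Longrightarrow> top1 X x"
  unfolding top1_def top2_def by (metis order_less_trans)

lemma top2_unique: "top2 X x x' \<Longrightarrow> top2 X z z' \<Longrightarrow> x = z \<and> x' = z'"
proof -
  assume *: "top2 X x x'" "top2 X z z'"
  then have "x = z" using top1_unique top2_top1 by blast
  with * have "x' = z'" unfolding top2_def by (metis order_less_asym order_less_irrefl)
  with \<open>x = z\<close> show ?thesis by simp
qed

lemma top2_exists:
  assumes "finite X" "2 \<le> card X"
  obtains x x' where "top2 X x x'"
proof -
  have "X \<noteq> {}" using assms by auto
  then obtain x where x: "top1 X x" using top1_exists assms(1) by blast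
  have "card (X - {x}) \<noteq> 0" using assms x by (auto simp: top1_def card_Diff_singleton)
  then have "X - {x} \<noteq> {}" by (metis card.empty)
  then obtain x' where "top1 (X - {x}) x'"
    using top1_exists[of "X - {x}"] assms(1) by blast
  then have "top2 X x x'" using x by (auto simp: top1_def top2_def)
  then show ?thesis using that by blast
qed

text \<open>Used contrapositively: with fewer than two points on a line, the class that joins its
  two rightmost points is empty, which matches a zero term of the recurrence.\<close>

lemma top2_card:
  assumes "finite X" "top2 X x x'"
  shows "2 \<le> card X"
proof -
  have "card {x, x'} = 2" "{x, x'} \<subseteq> X" using assms by (auto simp: top2_def)
  then show ?thesis using card_mono[OF assms(1)] by metis
qed

section \<open>Affine coordinates, the geometry of segments, and the recurrence for pairings\<close>

section \<open>Two parallel lines\<close>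

definition line_point :: "real^2 \<Rightarrow> real^2 \<Rightarrow> real \<Rightarrow> real^2" where
  "line_point a u x = a + x *\<^sub>R u"

text \<open>The lines pass through \<open>a\<close> and \<open>b\<close> with common direction
  \<open>u\<close>. Linear independence of \<open>u\<close> and \<open>b - a\<close> makes them
  proper and distinct.\<close>

locale two_lines =
  fixes a b u :: "real^2"
  assumes indep: "s *\<^sub>R u + t *\<^sub>R (b - a) = 0 \<Longrightarrow> s = 0 \<and> t = 0"
begin

abbreviation p :: "real \<Rightarrow> real^2" where "p \<equiv> line_point a u"
abbreviation q :: "real \<Rightarrow> real^2" where "q \<equiv> line_point b u"

text \<open>Affine coordinates of the plane: \<open>x\<close> is the position along the lines, and
  the height \<open>h\<close> is 0 on the first line and 1 on the second.\<close>

definition pt :: "real \<Rightarrow> real \<Rightarrow> real^2" where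
  "pt x h = a + x *\<^sub>R u + h *\<^sub>R (b - a)"

lemma p_pt: "p x = pt x 0" and q_pt: "q x = pt x 1"
  by (simp_all add: pt_def line_point_def)

lemma pt_eq: "pt x h = pt x' h' \<longleftrightarrow> x = x' \<and> h = h'"
proof
  assume "pt x h = pt x' h'"
  then have "(x - x') *\<^sub>R u + (h - h') *\<^sub>R (b - a) = 0"
    by (simp add: pt_def algebra_simps)
  from indep[OF this] show "x = x' \<and> h = h'" by simp
qed simp

lemma p_eq [simp]: "p x = p x' \<longleftrightarrow> x = x'"
  and q_eq [simp]: "q x = q x' \<longleftrightarrow> x = x'"
  and p_neq_q [simp]: "p x \<noteq> q y" "q y \<noteq> p x"
  by (simp_all add: p_pt q_pt pt_eq)

lemma closed_segment_pt:
  "closed_segment (pt x h) (pt x' h')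
    = {pt ((1 - t) * x + t * x') ((1 - t) * h + t * h') |t. 0 \<le> t \<and> t \<le> 1}"
proof -
  have "(1 - t) *\<^sub>R pt x h + t *\<^sub>R pt x' h'
      = pt ((1 - t) * x + t * x') ((1 - t) * h + t * h')" for t
    by (simp add: pt_def algebra_simps)
  then show ?thesis by (simp add: closed_segment_def)
qed

text \<open>By convexity one segment stays in a closed half-plane and the other in the complementary
  open one. The closed side allows a segment on the boundary itself.\<close>

lemma disjoint_by_separation:
  fixes \<beta> \<alpha> \<gamma> :: real
  assumes "\<gamma> \<le> \<alpha> * x1 + \<beta> * h1" "\<gamma> \<le> \<alpha> * x2 + \<beta> * h2"
    and "\<alpha> * x3 + \<beta> * h3 < \<gamma>" "\<alpha> * x4 + \<beta> * h4 < \<gamma>"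
  shows "closed_segment (pt x1 h1) (pt x2 h2) \<inter> closed_segment (pt x3 h3) (pt x4 h4) = {}"
proof (rule ccontr)
  assume "\<not> ?thesis"
  then obtain s t where s: "0 \<le> s" "s \<le> 1" and t: "0 \<le> t" "t \<le> 1"
    and eq: "(1 - s) * x1 + s * x2 = (1 - t) * x3 + t * x4"
      "(1 - s) * h1 + s * h2 = (1 - t) * h3 + t * h4"
    unfolding closed_segment_pt by (auto simp: pt_eq)
  have "\<gamma> = (1 - s) * \<gamma> + s * \<gamma>" by (simp add: algebra_simps)
  also have "\<dots> \<le> (1 - s) * (\<alpha> * x1 + \<beta> * h1) + s * (\<alpha> * x2 + \<beta> * h2)"
    using assms s by (intro add_mono mult_left_mono) auto
  also have "\<dots> = \<alpha> * ((1 - s) * x1 + s * x2) + \<beta> * ((1 - s) * h1 + s * h2)"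
    by (simp add: algebra_simps)
  also have "\<dots> = (1 - t) * (\<alpha> * x3 + \<beta> * h3) + t * (\<alpha> * x4 + \<beta> * h4)"
    unfolding eq by (simp add: algebra_simps)
  also have "\<dots> < \<gamma>"
    using convex_bound_lt[of "\<alpha> * x3 + \<beta> * h3" \<gamma> "\<alpha> * x4 + \<beta> * h4" "1 - t" t] assms t by simp
  finally show False by simp
qed

lemma segments_cross:
  assumes "x < x'" "y' < y"
  shows "closed_segment (p x) (q y) \<inter> closed_segment (p x') (q y') \<noteq> {}"
proof -
  \<comment> \<open>The height at which the horizontal gap between the segments,
    \<open>x' - x\<close> at height 0 and \<open>y' - y\<close> at height 1, vanishes.\<close>
  define t where "t = (x' - x) / ((x' - x) + (y - y'))"
  have t: "0 \<le> t" "t \<le> 1" using assms by (auto simp: t_def field_simps)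
  have "t * ((x' - x) + (y - y')) = x' - x"
    using assms by (simp add: t_def)
  then have "(1 - t) * x + t * y = (1 - t) * x' + t * y'"
    by (simp add: algebra_simps)
  then have "pt ((1 - t) * x + t * y) t
      \<in> closed_segment (p x) (q y) \<inter> closed_segment (p x') (q y')"
    unfolding p_pt q_pt closed_segment_pt using t by (auto simp: pt_eq)
  then show ?thesis by blast
qed

lemma p_between:
  assumes "x' < r" "r < x"
  shows "p r \<in> closed_segment (p x) (p x')"
proof -
  define t where "t = (x - r) / (x - x')"
  have "0 \<le> t" "t \<le> 1" using assms by (auto simp: t_def field_simps)
  moreover have "t * (x - x') = x - r" using assms by (simp add: t_def)
  then have "r = (1 - t) * x + t * x'" by (simp add: algebra_simps)
  ultimately show ?thesis unfolding p_pt closed_segment_pt by (auto simp: pt_eq)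
qed

lemma separated_edge_cross:
  assumes "top1 X x" "top1 Y y"
  shows "separated_edge (p ` X \<union> q ` Y) (p x) (q y)"
  unfolding separated_edge_def
proof (intro conjI ballI)
  fix r s
  assume rs: "r \<in> p ` X \<union> q ` Y - {p x, q y}" "s \<in> p ` X \<union> q ` Y - {p x, q y}"
  \<comment> \<open>all other points lie strictly on one side of the line through the rightmost points\<close>
  have "\<exists>z h. v = pt z h \<and> 1 * z + (x - y) * h < x"
    if "v \<in> p ` X \<union> q ` Y - {p x, q y}" for v
    using that assms unfolding top1_def p_pt q_pt by (auto simp: pt_eq)
  from this[OF rs(1)] this[OF rs(2)] obtain z h z' h'
    where "r = pt z h" "1 * z + (x - y) * h < x"
      "s = pt z' h'" "1 * z' + (x - y) * h' < x" by blast
  \<comment> \<open>Both ends of the edge attain the value \<open>x\<close>, so they lie on the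
    closed side.\<close>
  then show "closed_segment (p x) (q y) \<inter> closed_segment r s = {}"
    unfolding p_pt q_pt using disjoint_by_separation[of x 1 x "x - y" 0 y 1 z h z' h'] by simp
qed (use assms in \<open>auto simp: top1_def\<close>)

text \<open>The other points lie left of \<open>x'\<close> on the first line, or anywhere on the
  second. The separating line depends on where \<open>r\<close> and \<open>s\<close> lie.\<close>

lemma separated_edge_same:
  assumes "top2 X x x'"
  shows "separated_edge (p ` X \<union> q ` Y) (p x) (p x')"
  unfolding separated_edge_def
proof (intro conjI ballI)
  have x: "x' < x" using assms by (simp add: top2_def)
  fix r s
  assume rs: "r \<in> p ` X \<union> q ` Y - {p x, p x'}" "s \<in> p ` X \<union> q ` Y - {p x, p x'}"
  have *: "(\<exists>z<x'. v = pt z 0) \<or> (\<exists>z. v = pt z 1)"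
    if "v \<in> p ` X \<union> q ` Y - {p x, p x'}" for v
    using that assms unfolding top2_def p_pt q_pt by (auto simp: pt_eq)
  \<comment> \<open>The separating line runs through \<open>pt x' 0\<close> parallel to the second
    segment, on which the functional has the constant value \<open>z\<close>.\<close>
  have mixed: "closed_segment (pt x 0) (pt x' 0) \<inter> closed_segment (pt z 0) (pt z' 1) = {}"
    if "z < x'" for z z'
    using disjoint_by_separation[of x' 1 x "z - z'" 0 x' 0 z 0 z' 1] that x by simp
  from *[OF rs(1)] *[OF rs(2)]
  consider (11) z z' where "z < x'" "z' < x'" "r = pt z 0" "s = pt z' 0"
    | (12) z z' where "z < x'" "r = pt z 0" "s = pt z' 1"
    | (21) z z' where "z < x'" "s = pt z 0" "r = pt z' 1"
    | (22) z z' where "r = pt z 1" "s = pt z' 1"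
    by blast
  then show "closed_segment (p x) (p x') \<inter> closed_segment r s = {}"
  proof cases
    case 11
    then show ?thesis
      using disjoint_by_separation[of x' 1 x 0 0 x' 0 z 0 z' 0] x by (simp add: p_pt)
  next
    case 12
    then show ?thesis using mixed by (simp add: p_pt)
  next
    case 21
    then show ?thesis using mixed by (metis p_pt closed_segment_commute)
  next
    \<comment> \<open>Here the height alone separates.\<close>
    case 22
    then show ?thesis
      using disjoint_by_separation[of 0 0 x "-1" 0 x' 0 z 1 z' 1] by (simp add: p_pt)
  qed
qed (use assms in \<open>auto simp: top2_def\<close>)

text \<open>A point strictly between the two partners would lie on their segment and also be an end
  of another segment.\<close>

lemma same_line_partner:
  assumes M: "M \<in> noncrossing_pairings (p ` X \<union> q ` Y)"
    and "top1 X x" "x' \<in> X" and e: "{p x, p x'} \<in> M"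
  shows "top2 X x x'"
proof -
  have pr: "pairing (p ` X \<union> q ` Y) M" and ds: "disjoint_segments M"
    using M by (auto simp: noncrossing_pairings_def)
  have "x' \<noteq> x" using pairing_neq[OF pr e] by auto
  have "r < x'" if "r \<in> X - {x, x'}" for r
  proof (rule ccontr)
    assume "\<not> r < x'"
    then have "p r \<in> closed_segment (p x) (p x')"
      using that assms(2) by (intro p_between) (auto simp: top1_def)
    moreover have "p r \<in> p ` X \<union> q ` Y" using that by simp
    then obtain w where w: "{p r, w} \<in> M" using pairing_partner[OF pr] by blast
    moreover have "{p r, w} \<noteq> {p x, p x'}" using that by (auto simp: doubleton_eq_iff)
    moreover have "p r \<in> closed_segment (p r) w" by simp
    ultimately show False using ds e unfolding disjoint_segments_def by blast
  qed
  then show ?thesis using assms \<open>x' \<noteq> x\<close> by (auto simp: top1_def top2_def)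
qed

text \<open>If the two rightmost points had other partners across, these would lie further left, and
  the two segments would cross.\<close>

lemma cross_partner:
  assumes M: "M \<in> noncrossing_pairings (p ` X \<union> q ` Y)"
    and x: "top1 X x" "x' \<in> X" and y: "top1 Y y" "y' \<in> Y"
    and e: "{p x, q y'} \<in> M" and f: "{q y, p x'} \<in> M"
  shows "{p x, q y} \<in> M"
proof (cases "y' = y")
  case False
  have pr: "pairing (p ` X \<union> q ` Y) M" and ds: "disjoint_segments M"
    using M by (auto simp: noncrossing_pairings_def)
  have f': "{p x', q y} \<in> M" using f by (simp add: insert_commute)
  have "x' \<noteq> x" using pairing_partner_unique[OF pr e, of "q y"] f' False by auto
  then have "x' < x" "y' < y" using x y False by (auto simp: top1_def)
  then have "closed_segment (p x') (q y) \<inter> closed_segment (p x) (q y') \<noteq> {}"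
    by (rule segments_cross)
  moreover have "{p x', q y} \<noteq> {p x, q y'}"
    using False by (auto simp: doubleton_eq_iff)
  ultimately show ?thesis using ds e f' unfolding disjoint_segments_def by blast
qed (use e in simp)

text \<open>Facts about the first line thereby transfer to the second.\<close>

lemma swap: "two_lines b a u"
proof
  fix s t :: real
  assume "s *\<^sub>R u + t *\<^sub>R (a - b) = 0"
  then have "s *\<^sub>R u + (- t) *\<^sub>R (b - a) = 0" by (simp add: algebra_simps)
  from indep[OF this] show "s = 0 \<and> t = 0" by simp
qed

text \<open>If the rightmost point of some line has its partner on the same line,
  \<open>same_line_partner\<close> applies; if both have partners across,
  \<open>cross_partner\<close> does.\<close>

lemma rightmost_cases:
  assumes "finite X" "finite Y" "X \<noteq> {} \<or> Y \<noteq> {}"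
    and M: "M \<in> noncrossing_pairings (p ` X \<union> q ` Y)"
  shows "(\<exists>x x'. top2 X x x' \<and> {p x, p x'} \<in> M) \<or> (\<exists>y y'. top2 Y y y' \<and> {q y, q y'} \<in> M)
    \<or> (\<exists>x y. top1 X x \<and> top1 Y y \<and> {p x, q y} \<in> M)"
proof -
  interpret sw: two_lines b a u by (rule swap)
  have M': "M \<in> noncrossing_pairings (q ` Y \<union> p ` X)" using M by (simp add: Un_commute)
  have pr: "pairing (p ` X \<union> q ` Y) M" using M by (simp add: noncrossing_pairings_def)
  have X: "(\<exists>x'. top2 X x x' \<and> {p x, p x'} \<in> M) \<or> (\<exists>y'\<in>Y. {p x, q y'} \<in> M)"
    if "top1 X x" for x
  proof -
    have "p x \<in> p ` X \<union> q ` Y" using that by (simp add: top1_def)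
    then obtain w where "w \<in> p ` X \<union> q ` Y" "{p x, w} \<in> M" using pairing_partner[OF pr] by blast
    then show ?thesis using same_line_partner[OF M that] by blast
  qed
  have Y: "(\<exists>y'. top2 Y y y' \<and> {q y, q y'} \<in> M) \<or> (\<exists>x'\<in>X. {q y, p x'} \<in> M)"
    if "top1 Y y" for y
  proof -
    have "q y \<in> p ` X \<union> q ` Y" using that by (simp add: top1_def)
    then obtain w where "w \<in> p ` X \<union> q ` Y" "{q y, w} \<in> M" using pairing_partner[OF pr] by blast
    then show ?thesis using sw.same_line_partner[OF M' that] by blast
  qed
  show ?thesis
  proof (cases "X = {} \<or> Y = {}")
    case True
    \<comment> \<open>With one line empty, the rightmost point of the other has no partner
      across.\<close>
    then show ?thesis using X Y assms top1_exists by (metis empty_iff)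
  next
    case False
    then obtain x y where "top1 X x" "top1 Y y" using top1_exists assms by metis
    then show ?thesis using X Y cross_partner[OF M] by meson
  qed
qed

lemma remove_same_line:
  "top2 X x x' \<Longrightarrow> p ` X \<union> q ` Y - {p x, p x'} = p ` (X - {x, x'}) \<union> q ` Y"
  by auto

lemma remove_cross: "p ` X \<union> q ` Y - {p x, q y} = p ` (X - {x}) \<union> q ` (Y - {y})"
  by auto

lemma card_remove_top2: "finite X \<Longrightarrow> top2 X x x' \<Longrightarrow> card (X - {x, x'}) = card X - 2"
  by (subst card_Diff_subset) (auto simp: top2_def)

text \<open>Induction on the number of points: the three classes of \<open>rightmost_cases\<close>
  give the same recurrence as the compositions. In particular only the numbers of points
  matter.\<close>

lemma card_noncrossing_pairings:
  "finite X \<Longrightarrow> finite Y \<Longrightarrow>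
    card (noncrossing_pairings (p ` X \<union> q ` Y)) = card (composition_pairs (card X) (card Y))"
proof (induction "card X + card Y" arbitrary: X Y rule: less_induct)
  case less
  interpret sw: two_lines b a u by (rule swap)
  let ?S = "p ` X \<union> q ` Y"
  let ?k = "card X" and ?n = "card Y"
  have fin: "finite X" "finite Y" by fact+
  show ?case
  proof (cases "X = {} \<and> Y = {}")
    case True
    then show ?thesis by (simp add: noncrossing_pairings_empty composition_pairs_0_0)
  next
    case False
    define A where "A = {M \<in> noncrossing_pairings ?S. \<exists>x x'. top2 X x x' \<and> {p x, p x'} \<in> M}"
    define B where "B = {M \<in> noncrossing_pairings ?S. \<exists>y y'. top2 Y y y' \<and> {q y, q y'} \<in> M}"
    define C where "C = {M \<in> noncrossing_pairings ?S.
      \<exists>x y. top1 X x \<and> top1 Y y \<and> {p x, q y} \<in> M}"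
    \<comment> \<open>Rightmost points are unique, so each class prescribes one fixed edge, as the
      deletion bijection expects.\<close>
    have A_eq: "A = {M \<in> noncrossing_pairings ?S. {p x, p x'} \<in> M}" if "top2 X x x'" for x x'
      unfolding A_def by (intro Collect_cong) (metis that top2_unique)
    have B_eq: "B = {M \<in> noncrossing_pairings ?S. {q y, q y'} \<in> M}" if "top2 Y y y'" for y y'
      unfolding B_def by (intro Collect_cong) (metis that top2_unique)
    have C_eq: "C = {M \<in> noncrossing_pairings ?S. {p x, q y} \<in> M}"
      if "top1 X x" "top1 Y y" for x y
      unfolding C_def by (intro Collect_cong) (metis that top1_unique)
    \<comment> \<open>The set \<open>X'\<close> is arbitrary because the overlap of \<open>A\<close>
      and \<open>B\<close> uses this after two points of \<open>X\<close> are gone.\<close>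
    have sepY: "separated_edge (p ` X' \<union> q ` Y) (q y) (q y')" if "top2 Y y y'" for X' y y'
      using sw.separated_edge_same[OF that, of X'] by (simp add: Un_commute)
    have remY: "p ` X' \<union> q ` Y - {q y, q y'} = p ` X' \<union> q ` (Y - {y, y'})"
      for X' y y' by auto
    have cardA: "card A = (if 2 \<le> ?k then card (composition_pairs (?k - 2) ?n) else 0)"
    proof (cases "2 \<le> ?k")
      case True
      then obtain x x' where x: "top2 X x x'" using top2_exists fin by blast
      have "card A = card (noncrossing_pairings (p ` (X - {x, x'}) \<union> q ` Y))"
        unfolding A_eq[OF x] remove_same_line[OF x, symmetric]
        by (rule card_noncrossing_pairings_remove1[OF separated_edge_same[OF x]])
      also have "\<dots> = card (composition_pairs (?k - 2) ?n)"
        using less.hyps[of "X - {x, x'}" Y] fin True card_remove_top2[OF fin(1) x] by simp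
      finally show ?thesis using True by simp
    next
      case False
      then have "A = {}" using top2_card[OF fin(1)] by (auto simp: A_def)
      then show ?thesis using False by simp
    qed
    have cardB: "card B = (if 2 \<le> ?n then card (composition_pairs ?k (?n - 2)) else 0)"
    proof (cases "2 \<le> ?n")
      case True
      then obtain y y' where y: "top2 Y y y'" using top2_exists fin by blast
      have "card B = card (noncrossing_pairings (p ` X \<union> q ` (Y - {y, y'})))"
        unfolding B_eq[OF y] remY[symmetric]
        by (rule card_noncrossing_pairings_remove1[OF sepY[OF y]])
      also have "\<dots> = card (composition_pairs ?k (?n - 2))"
        using less.hyps[of X "Y - {y, y'}"] fin True card_remove_top2[OF fin(2) y] by simp
      finally show ?thesis using True by simp
    next
      case False
      then have "B = {}" using top2_card[OF fin(2)] by (auto simp: B_def)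
      then show ?thesis using False by simp
    qed
    have cardC: "card C =
      (if 1 \<le> ?k \<and> 1 \<le> ?n then card (composition_pairs (?k - 1) (?n - 1)) else 0)"
    proof (cases "1 \<le> ?k \<and> 1 \<le> ?n")
      case True
      then have "X \<noteq> {}" "Y \<noteq> {}" by auto
      then obtain x y where x: "top1 X x" and y: "top1 Y y" using top1_exists fin by metis
      have "card C = card (noncrossing_pairings (p ` (X - {x}) \<union> q ` (Y - {y})))"
        unfolding C_eq[OF x y] remove_cross[symmetric]
        by (rule card_noncrossing_pairings_remove1[OF separated_edge_cross[OF x y]])
      also have "\<dots> = card (composition_pairs (?k - 1) (?n - 1))"
      proof -
        have "card (X - {x}) = ?k - 1" "card (Y - {y}) = ?n - 1"
          using x y by (auto simp: top1_def)
        then show ?thesis using less.hyps[of "X - {x}" "Y - {y}"] fin True by simp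
      qed
      finally show ?thesis using True by simp
    next
      case False
      then have "X = {} \<or> Y = {}" using fin by (auto simp: Suc_le_eq card_gt_0_iff)
      then have "C = {}" by (auto simp: C_def top1_def)
      then show ?thesis using False by auto
    qed
    have cardAB: "card (A \<inter> B) =
      (if 2 \<le> ?k \<and> 2 \<le> ?n then card (composition_pairs (?k - 2) (?n - 2)) else 0)"
    proof (cases "2 \<le> ?k \<and> 2 \<le> ?n")
      case True
      then obtain x x' where x: "top2 X x x'" using top2_exists fin by blast
      obtain y y' where y: "top2 Y y y'" using top2_exists fin True by blast
      have ne: "{q y, q y'} \<noteq> {p x, p x'}" by (auto simp: doubleton_eq_iff)
      \<comment> \<open>The second edge is required in the remainder of \<open>M\<close>, to fit the
        predicate \<open>F\<close> of the deletion lemma.\<close>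
      have AB: "A \<inter> B = {M \<in> noncrossing_pairings ?S. {p x, p x'} \<in> M
          \<and> {q y, q y'} \<in> M - {{p x, p x'}}}"
        unfolding A_eq[OF x] B_eq[OF y] using ne by auto
      have "card (A \<inter> B)
          = card {M \<in> noncrossing_pairings (p ` (X - {x, x'}) \<union> q ` Y). {q y, q y'} \<in> M}"
        unfolding AB remove_same_line[OF x, symmetric]
        by (rule card_noncrossing_pairings_remove[OF separated_edge_same[OF x]])
      also have "\<dots> = card (noncrossing_pairings (p ` (X - {x, x'}) \<union> q ` (Y - {y, y'})))"
        unfolding remY[symmetric]
        by (rule card_noncrossing_pairings_remove1[OF sepY[OF y]])
      also have "\<dots> = card (composition_pairs (?k - 2) (?n - 2))"
        using less.hyps[of "X - {x, x'}" "Y - {y, y'}"] fin True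
          card_remove_top2[OF fin(1) x] card_remove_top2[OF fin(2) y] by simp
      finally show ?thesis using True by simp
    next
      case False
      then have "A \<inter> B = {}"
        using top2_card[OF fin(1)] top2_card[OF fin(2)] by (auto simp: A_def B_def)
      then show ?thesis using False by auto
    qed
    have "noncrossing_pairings ?S = A \<union> B \<union> C"
      using rightmost_cases[OF fin] False by (auto simp: A_def B_def C_def)
    moreover have "(A \<union> B) \<inter> C = {}"
    proof -
      \<comment> \<open>A rightmost point would have two partners, one on each line.\<close>
      have False if "M \<in> C" and AB: "M \<in> A \<union> B" for M
      proof -
        obtain x y where xy: "top1 X x" "top1 Y y" "{p x, q y} \<in> M"
          using \<open>M \<in> C\<close> by (auto simp: C_def)
        have pr: "pairing ?S M"
          using \<open>M \<in> C\<close> by (auto simp: C_def noncrossing_pairings_def)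
        have yx: "{q y, p x} \<in> M" using xy by (simp add: insert_commute)
        from AB consider x' where "{p x, p x'} \<in> M" | y' where "{q y, q y'} \<in> M"
          unfolding A_def B_def using xy top1_unique top2_top1 by blast
        then show False
          using pairing_partner_unique[OF pr xy(3)] pairing_partner_unique[OF pr yx] by cases (metis p_neq_q)+
      qed
      then show ?thesis by blast
    qed
    ultimately have "card (noncrossing_pairings ?S) + card (A \<inter> B) = card A + card B + card C"
      using fin by (intro card_three_cover finite_noncrossing_pairings) auto
    moreover have "(?k, ?n) \<noteq> (0, 0)" using False fin by auto
    ultimately show ?thesis
      using card_composition_pairs[of ?k ?n] unfolding cardA cardB cardC cardAB by linarith
  qed
qed

end

text \<open>Two affinely independent points of the first line give \<open>a\<close> and
  \<open>u\<close>; the translation vector between the lines gives \<open>b\<close>.\<close>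

lemma parallel_lines_coordinates:
  assumes "parallel_lines L\<^sub>1 L\<^sub>2"
  obtains a b u where "two_lines a b u"
    "L\<^sub>1 = range (line_point a u)" "L\<^sub>2 = range (line_point b u)"
proof -
  have L: "affine L\<^sub>1" "aff_dim L\<^sub>1 = 1" "affine_parallel L\<^sub>1 L\<^sub>2" "L\<^sub>1 \<noteq> L\<^sub>2"
    using assms by (auto simp: parallel_lines_def)
  obtain B where B: "affine hull B = affine hull L\<^sub>1" "int (card B) = aff_dim L\<^sub>1 + 1"
    using aff_dim_basis_exists by metis
  then have "card B = 2" using L by simp
  then obtain a a' where a: "B = {a, a'}" "a \<noteq> a'" by (auto simp: card_2_iff)
  define u where "u = a' - a"
  have "L\<^sub>1 = affine hull {a, a'}" using B(1) a(1) affine_hull_eq[THEN iffD2, OF L(1)] by simp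
  then have L1: "L\<^sub>1 = range (line_point a u)"
    by (auto simp: affine_hull_2_alt u_def line_point_def)
  obtain c where c: "L\<^sub>2 = (\<lambda>x. c + x) ` L\<^sub>1"
    using L by (auto simp: affine_parallel_def)
  have L2: "L\<^sub>2 = range (line_point (a + c) u)"
    unfolding c L1 by (auto simp: image_image line_point_def algebra_simps)
  have "two_lines a (a + c) u"
  proof
    fix s t :: real
    assume "s *\<^sub>R u + t *\<^sub>R (a + c - a) = 0"
    then have st: "s *\<^sub>R u + t *\<^sub>R c = 0" by simp
    \<comment> \<open>Otherwise \<open>c\<close> is a multiple of \<open>u\<close>, so translation
      by \<open>c\<close> maps the first line to itself and the lines coincide.\<close>
    have "t = 0"
    proof (rule ccontr)
      assume "t \<noteq> 0"
      have "t *\<^sub>R c = (- s) *\<^sub>R u" using st by (simp add: add_eq_0_iff)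
      then have "(1 / t) *\<^sub>R t *\<^sub>R c = (1 / t) *\<^sub>R (- s) *\<^sub>R u" by simp
      then have cu: "c = (- s / t) *\<^sub>R u" using \<open>t \<noteq> 0\<close> by simp
      define d where "d = - s / t"
      have *: "line_point (a + c) u x = line_point a u (d + x)" for x
        by (simp add: line_point_def cu d_def algebra_simps)
      have "line_point a u x = line_point (a + c) u (x - d)" for x
        by (simp add: *)
      with * have "range (line_point (a + c) u) = range (line_point a u)" by blast
      then show False using L L1 L2 by simp
    qed
    moreover have "u \<noteq> 0" using a by (simp add: u_def)
    ultimately show "s = 0 \<and> t = 0" using st by simp
  qed
  then show ?thesis using that L1 L2 by blast
qed

theorem mainTheorem3:
  fixes k n :: nat and L\<^sub>1 L\<^sub>2 P Q :: "(real^2) set"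
  assumes "parallel_lines L\<^sub>1 L\<^sub>2"
    and "P \<subseteq> L\<^sub>1" and "finite P" and "card P = k"
    and "Q \<subseteq> L\<^sub>2" and "finite Q" and "card Q = n"
  shows "num_pairings P Q =
    card {(c\<^sub>1, c\<^sub>2). composition k c\<^sub>1 \<and> set c\<^sub>1 \<subseteq> {1, 2} \<and>
                   composition n c\<^sub>2 \<and> set c\<^sub>2 \<subseteq> {1, 2} \<and>
                   count_list c\<^sub>1 1 = count_list c\<^sub>2 1}"
proof -
  obtain a b u where "two_lines a b u"
    and L: "L\<^sub>1 = range (line_point a u)" "L\<^sub>2 = range (line_point b u)"
    using parallel_lines_coordinates assms(1) by blast
  then interpret two_lines a b u by simp
  \<comment> \<open>Injectivity makes the coordinate sets as large as the sets of marked
    points.\<close>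
  have inj: "inj_on p A" "inj_on q A" for A by (auto intro: inj_onI)
  obtain X where X: "P = p ` X"
    using assms(2) L(1) subset_imageE by metis
  obtain Y where Y: "Q = q ` Y"
    using assms(5) L(2) subset_imageE by metis
  have "finite X" "finite Y" "card X = k" "card Y = n"
    using assms X Y inj by (auto simp: finite_image_iff card_image)
  then have "num_pairings P Q = card (composition_pairs k n)"
    using card_noncrossing_pairings[of X Y] X Y
    by (simp add: num_pairings_def noncrossing_pairings_def)
  then show ?thesis by (simp add: composition_pairs_def)
qed

end
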